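(* Let $n\geq r\geq 3$ and $t\geq 3$ be integers, and let $H$ be a linear $r$-graph with $n$ vertices. Let $u,w\in V(H)$ be two adjacent vertices and let $v\in N_u(H)\setminus\{w\}$. Suppose $W\subseteq N_{vuw}\setminus(l_{vu}\cup l_{vw}\cup l_{uw})$ is such that any two distinct vertices $u_1,u_2\in W$ satisfy $l_{vu_1}\neq l_{vu_2}$. If $|W|\geq (t-1)(r-1)+1$, then $H$ contains a Berge-$K_{3,t}$.
   Context: An $r$-graph $H$ has edges that are $r$-element subsets of $V(H)$; it is linear if any two distinct edges share at most one vertex. Two vertices are adjacent if some edge contains both; $N_x(H)$ is the set of vertices adjacent to $x$, and $N_{x_1\cdots x_k}=N_{x_1}(H)\cap\cdots\cap N_{x_k}(H)$. For adjacent vertices $a,b$, $l_{ab}$ denotes the unique edge containing both $a$ and $b$ (unique by linearity); if $a,b$ are not adjacent, $l_{ab}=\emptyset$. For a simple graph $F$, a hypergraph is a Berge-$F$ if there is a bijection $\phi:E(F)\to E$ from the edges of $F$ to its edges with $e\subseteq\phi(e)$ for all $e\in E(F)$; $H$ contains a Berge-$F$ if some subset of $E(H)$ forms a Berge-$F$. $K_{3,t}$ is the complete bipartite graph with parts of sizes $3$ and $t$. *)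

theory Defs
  imports Main
begin

record 'a hypergraph =
  verts :: "'a set"
  edges :: "'a set set"

definition r_graph :: "nat \<Rightarrow> 'a hypergraph \<Rightarrow> bool" where
  "r_graph r H \<longleftrightarrow>
     finite (verts H) \<and> (\<forall>e\<in>edges H. e \<subseteq> verts H \<and> card e = r)"

definition linear_hypergraph :: "'a hypergraph \<Rightarrow> bool" where
  "linear_hypergraph H \<longleftrightarrow>
     (\<forall>e\<in>edges H. \<forall>f\<in>edges H. e \<noteq> f \<longrightarrow> card (e \<inter> f) \<le> 1)"

(* Adjacency relates distinct vertices only: no vertex is its own neighbour. *)
definition adjacent :: "'a hypergraph \<Rightarrow> 'a \<Rightarrow> 'a \<Rightarrow> bool" where
  "adjacent H x y \<longleftrightarrow> x \<noteq> y \<and> (\<exists>e\<in>edges H. x \<in> e \<and> y \<in> e)"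

definition nbhd :: "'a hypergraph \<Rightarrow> 'a \<Rightarrow> 'a set" where
  "nbhd H x = {y \<in> verts H. adjacent H x y}"

(* The edge l_ab; the description is proper when H is a linear r-graph. *)
definition line :: "'a hypergraph \<Rightarrow> 'a \<Rightarrow> 'a \<Rightarrow> 'a set" where
  "line H a b =
     (if adjacent H a b then (THE e. e \<in> edges H \<and> a \<in> e \<and> b \<in> e) else {})"

lemma line_unique:
  assumes "r_graph r H" "linear_hypergraph H" "adjacent H a b"
  shows "\<exists>!e. e \<in> edges H \<and> a \<in> e \<and> b \<in> e"
proof -
  from assms(3) obtain e where e: "e \<in> edges H" "a \<in> e" "b \<in> e" and ab: "a \<noteq> b"
    by (auto simp: adjacent_def)
  have "f = e" if f: "f \<in> edges H" "a \<in> f" "b \<in> f" for f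
  proof (rule ccontr)
    assume "f \<noteq> e"
    then have le: "card (f \<inter> e) \<le> 1"
      using assms(2) e f by (auto simp: linear_hypergraph_def)
    have "finite (f \<inter> e)"
      using assms(1) e by (meson finite_Int finite_subset r_graph_def)
    moreover have "{a, b} \<subseteq> f \<inter> e" using e f by auto
    ultimately have "card {a, b} \<le> card (f \<inter> e)" by (rule card_mono)
    with le ab show False by simp
  qed
  with e show ?thesis by blast
qed

(* A simple graph F is a 2-graph.  The map f places the vertices of F among those of H,
   so that the edge {x, y} of F becomes the pair {f x, f y} of vertices of H. *)
definition is_Berge :: "'b hypergraph \<Rightarrow> 'a hypergraph \<Rightarrow> bool" where
  "is_Berge F H \<longleftrightarrow>
     (\<exists>f \<phi>. inj_on f (verts F) \<and> f ` verts F \<subseteq> verts H \<and>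
        bij_betw \<phi> (edges F) (edges H) \<and> (\<forall>e\<in>edges F. f ` e \<subseteq> \<phi> e))"

definition contains_Berge :: "'a hypergraph \<Rightarrow> 'b hypergraph \<Rightarrow> bool" where
  "contains_Berge H F \<longleftrightarrow>
     (\<exists>E \<subseteq> edges H. is_Berge F \<lparr>verts = verts H, edges = E\<rparr>)"

definition complete_bipartite :: "nat \<Rightarrow> nat \<Rightarrow> (nat + nat) hypergraph" where
  "complete_bipartite s t =
     \<lparr>verts = Inl ` {..<s} \<union> Inr ` {..<t},
      edges = {{Inl i, Inr j} | i j. i < s \<and> j < t}\<rparr>"

lemma complete_bipartite_simple: "r_graph 2 (complete_bipartite s t)"
  by (auto simp: r_graph_def complete_bipartite_def)

end

theory Submission
  imports Defs
begin

text \<open>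
  By linearity, a line joining one of \<open>u, v, w\<close> to a vertex of \<open>W\<close> contains only that one of
  the three. Lines through \<open>v\<close> are distinct by hypothesis, so coincidences can only occur among the lines through \<open>u\<close> or among those through
  \<open>w\<close>. Send \<open>x \<in> W\<close> to the pair \<open>(l\<^sub>u\<^sub>x, l\<^sub>w\<^sub>x)\<close>. This is injective, so it
  gives a bipartite graph with \<open>|W|\<close> edges whose degrees are at most \<open>r - 1\<close>. Its vertex covers
  have at least \<open>t\<close> elements, so by Koenig's theorem it has a matching of size \<open>t\<close>: this is a set
  of \<open>t\<close> vertices of \<open>W\<close> for which all \<open>3t\<close> lines are distinct.
\<close>

section \<open>Vertex covers and matchings in finite bipartite graphs\<close>

text \<open>Edges are ordered pairs, which keeps the two sides apart even when both have the same
  type. Finiteness is demanded because \<open>card\<close> is 0 on infinite sets, so an infinite set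
  would pass as a cover of size 0.\<close>

definition covers :: "'a set \<Rightarrow> 'b set \<Rightarrow> ('a \<times> 'b) set \<Rightarrow> bool" where
  "covers X Y E \<longleftrightarrow> finite X \<and> finite Y \<and> (\<forall>(a, b)\<in>E. a \<in> X \<or> b \<in> Y)"

definition matching :: "('a \<times> 'b) set \<Rightarrow> bool" where
  "matching M \<longleftrightarrow> inj_on fst M \<and> inj_on snd M"

text \<open>
  The two parts of a tight cover are each covered no more cheaply inside the subgraph that they
  alone cover; matchings of these two vertex-disjoint subgraphs can be combined.
\<close>

lemma matching_from_tight_cover:
  fixes E :: "('a \<times> 'b) set"
  assumes fin: "finite E"
    and cov: "covers X Y E" and tight: "card X + card Y = k"
    and ne: "X \<noteq> {}" "Y \<noteq> {}"
    and min: "\<And>P Q. covers P Q E \<Longrightarrow> k \<le> card P + card Q"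
    and IH: "\<And>E' :: ('a \<times> 'b) set. \<And>j. E' \<subset> E \<Longrightarrow>
      (\<And>P Q. covers P Q E' \<Longrightarrow> j \<le> card P + card Q) \<Longrightarrow>
      \<exists>M\<subseteq>E'. matching M \<and> card M = j"
  shows "\<exists>M\<subseteq>E. matching M \<and> card M = k"
proof -
  define E1 where "E1 = {(a, b)\<in>E. a \<in> X \<and> b \<notin> Y}"
  define E2 where "E2 = {(a, b)\<in>E. a \<notin> X \<and> b \<in> Y}"
  have finXY: "finite X" "finite Y"
    using cov by (auto simp: covers_def)
  then have pos: "card X > 0" "card Y > 0"
    using ne by (auto simp: card_gt_0_iff)
  have "E1 \<noteq> E"
  proof
    assume "E1 = E"
    then have "covers X ({} :: 'b set) E"
      using finXY by (auto simp: covers_def E1_def)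
    from min[OF this] show False using tight pos by simp
  qed
  then have sub1: "E1 \<subset> E" by (auto simp: E1_def)
  have "E2 \<noteq> E"
  proof
    assume "E2 = E"
    then have "covers ({} :: 'a set) Y E"
      using finXY by (auto simp: covers_def E2_def)
    from min[OF this] show False using tight pos by simp
  qed
  then have sub2: "E2 \<subset> E" by (auto simp: E2_def)
  have "card X \<le> card P + card Q" if "covers P Q E1" for P Q
  proof -
    \<comment> \<open>An edge of \<open>E\<close> missed by \<open>Y\<close> has its first end in
      \<open>X\<close>, hence lies in \<open>E1\<close> and is covered by \<open>P\<close> and
      \<open>Q\<close>.\<close>
    have "covers P (Q \<union> Y) E"
      using that cov by (fastforce simp: covers_def E1_def)
    from min[OF this] show ?thesis
      using tight card_Un_le[of Q Y] by linarith
  qed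
  from IH[OF sub1 this] obtain M1
    where M1: "M1 \<subseteq> E1" "matching M1" "card M1 = card X" by blast
  have "card Y \<le> card P + card Q" if "covers P Q E2" for P Q
  proof -
    have "covers (P \<union> X) Q E"
      using that cov by (fastforce simp: covers_def E2_def)
    from min[OF this] show ?thesis
      using tight card_Un_le[of P X] by linarith
  qed
  from IH[OF sub2 this] obtain M2
    where M2: "M2 \<subseteq> E2" "matching M2" "card M2 = card Y" by blast
  have disj: "fst ` M1 \<inter> fst ` M2 = {}" "snd ` M1 \<inter> snd ` M2 = {}"
    using M1(1) M2(1) by (auto simp: E1_def E2_def)
  then have "matching (M1 \<union> M2)"
    using M1(2) M2(2) unfolding matching_def inj_on_Un by blast
  moreover have sub: "M1 \<union> M2 \<subseteq> E"
    using M1(1) M2(1) sub1 sub2 by blast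
  moreover have "card (M1 \<union> M2) = k"
  proof -
    have "finite M1" "finite M2"
      using sub fin by (auto intro: finite_subset)
    moreover have "M1 \<inter> M2 = {}" using disj by blast
    ultimately show ?thesis using M1(3) M2(3) tight by (simp add: card_Un_disjoint)
  qed
  ultimately show ?thesis by blast
qed

text \<open>Delete an edge \<open>(a, b)\<close>. If covers of the rest still need \<open>k\<close>
  vertices, the induction hypothesis suffices. Otherwise a smaller cover of the rest becomes a tight
  cover of \<open>E\<close> by adding either \<open>a\<close> or \<open>b\<close>, and one of the
  two has both parts nonempty unless \<open>k = 1\<close>.\<close>

theorem koenig:
  fixes E :: "('a \<times> 'b) set"
  assumes "finite E" and "\<And>X Y. covers X Y E \<Longrightarrow> k \<le> card X + card Y"
  shows "\<exists>M\<subseteq>E. matching M \<and> card M = k"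
  using assms
proof (induction E arbitrary: k rule: finite_psubset_induct)
  case (psubset E)
  have IH: "\<exists>M\<subseteq>E'. matching M \<and> card M = j"
    if "E' \<subset> E" "\<And>P Q. covers P Q E' \<Longrightarrow> j \<le> card P + card Q" for E' :: "('a \<times> 'b) set" and j
    using psubset.IH[OF that] .
  show ?case
  proof (cases "E = {}")
    case True
    then have "covers ({} :: 'a set) ({} :: 'b set) E" by (simp add: covers_def)
    from psubset.prems[OF this] have "k = 0" by simp
    then show ?thesis by (intro exI[of _ "{}"]) (simp add: matching_def)
  next
    case False
    then obtain a b where ab: "(a, b) \<in> E" by auto
    show ?thesis
    proof (cases "\<forall>X Y. covers X Y (E - {(a, b)}) \<longrightarrow> k \<le> card X + card Y")
      case True
      then show ?thesis using IH[of "E - {(a, b)}" k] ab by blast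
    next
      case False
      then obtain X Y where XY: "covers X Y (E - {(a, b)})" "card X + card Y < k"
        by (auto simp: not_le)
      have finXY: "finite X" "finite Y" using XY(1) by (auto simp: covers_def)
      have cova: "covers (insert a X) Y E" and covb: "covers X (insert b Y) E"
        using XY(1) by (auto simp: covers_def)
      \<comment> \<open>One new vertex raises a size below \<open>k\<close> to at most
        \<open>k\<close>, while every cover of \<open>E\<close> has size at least
        \<open>k\<close>.\<close>
      have ka: "card (insert a X) + card Y = k"
        using psubset.prems[OF cova] XY(2) finXY by (simp add: card_insert_if split: if_splits)
      have kb: "card X + card (insert b Y) = k"
        using psubset.prems[OF covb] XY(2) finXY by (simp add: card_insert_if split: if_splits)
      consider "Y \<noteq> {}" | "X \<noteq> {}" | "X = {}" "Y = {}" by blast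
      then show ?thesis
      proof cases
        case 1
        show ?thesis
          by (rule matching_from_tight_cover[OF \<open>finite E\<close> cova ka _ 1 psubset.prems IH]) auto
      next
        case 2
        show ?thesis
          by (rule matching_from_tight_cover[OF \<open>finite E\<close> covb kb 2 _ psubset.prems IH]) auto
      next
        case 3
        then have "k = 1" using ka by simp
        then show ?thesis
          using ab by (intro exI[of _ "{(a, b)}"]) (simp add: matching_def)
      qed
    qed
  qed
qed

text \<open>A set of \<open>m\<close> vertices meets at most \<open>m * d\<close> edges, so more
  than \<open>k * d\<close> edges need a cover of at least \<open>k + 1\<close> vertices.\<close>

lemma matching_of_bounded_degree:
  assumes "finite E"
    and fst_le: "\<And>a. card {p\<in>E. fst p = a} \<le> d"
    and snd_le: "\<And>b. card {p\<in>E. snd p = b} \<le> d"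
    and large: "card E > k * d"
  shows "\<exists>M\<subseteq>E. matching M \<and> card M = Suc k"
proof (rule koenig[OF \<open>finite E\<close>])
  fix X Y assume cov: "covers X Y E"
  then have fin: "finite X" "finite Y" by (auto simp: covers_def)
  have "E \<subseteq> (\<Union>a\<in>X. {p\<in>E. fst p = a}) \<union> (\<Union>b\<in>Y. {p\<in>E. snd p = b})"
    using cov by (auto simp: covers_def)
  then have "card E \<le> card ((\<Union>a\<in>X. {p\<in>E. fst p = a}) \<union> (\<Union>b\<in>Y. {p\<in>E. snd p = b}))"
    using fin \<open>finite E\<close> by (intro card_mono) auto
  also have "\<dots> \<le> card (\<Union>a\<in>X. {p\<in>E. fst p = a}) + card (\<Union>b\<in>Y. {p\<in>E. snd p = b})"
    by (rule card_Un_le)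
  also have "\<dots> \<le> (\<Sum>a\<in>X. card {p\<in>E. fst p = a}) + (\<Sum>b\<in>Y. card {p\<in>E. snd p = b})"
    using fin by (intro add_mono card_UN_le)
  also have "\<dots> \<le> card X * d + card Y * d"
    using sum_bounded_above[of X _ d] sum_bounded_above[of Y _ d] fst_le snd_le
    by (intro add_mono) auto
  finally have "k * d < (card X + card Y) * d"
    using large by (simp add: distrib_right)
  then show "Suc k \<le> card X + card Y"
    by (simp add: Suc_le_eq)
qed

section \<open>Lines of a linear hypergraph and Berge copies\<close>

lemma adjacent_line:
  assumes "r_graph r H" "linear_hypergraph H" "adjacent H a b"
  shows "line H a b \<in> edges H" "a \<in> line H a b" "b \<in> line H a b"
  using theI'[OF line_unique[OF assms]] assms(3) by (auto simp: line_def)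

lemma line_eqI:
  assumes "r_graph r H" "linear_hypergraph H"
    and "e \<in> edges H" "a \<in> e" "b \<in> e" "a \<noteq> b"
  shows "line H a b = e"
proof -
  have "adjacent H a b" using assms by (auto simp: adjacent_def)
  from line_unique[OF assms(1,2) this] adjacent_line[OF assms(1,2) this] assms(3-5)
  show ?thesis by blast
qed

lemma contains_Berge_complete_bipartite:
  fixes H :: "'a hypergraph" and p q :: "nat \<Rightarrow> 'a"
  assumes H: "r_graph r H" "linear_hypergraph H"
    and inj: "inj_on p {..<s}" "inj_on q {..<t}"
    and verts: "p ` {..<s} \<subseteq> verts H" "q ` {..<t} \<subseteq> verts H"
    and adj: "\<And>i j. i < s \<Longrightarrow> j < t \<Longrightarrow> adjacent H (p i) (q j)"
    and inj_line: "inj_on (\<lambda>(i, j). line H (p i) (q j)) ({..<s} \<times> {..<t})"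
  shows "contains_Berge H (complete_bipartite s t)"
proof -
  let ?K = "complete_bipartite s t"
  define f where "f = case_sum p q"
  \<comment> \<open>The edge \<open>e\<close> is an unordered pair, so its ends cannot be projected
    out; containment of the image needs no order and unfolds to \<open>line\<close> on adjacent
    vertices.\<close>
  define \<phi> where "\<phi> = (\<lambda>e. THE l. l \<in> edges H \<and> f ` e \<subseteq> l)"
  have \<phi>: "\<phi> {Inl i, Inr j} = line H (p i) (q j)" if "i < s" "j < t" for i j
    using adj[OF that] by (simp add: \<phi>_def f_def line_def)
  \<comment> \<open>Images of vertices from opposite sides differ because adjacent vertices are
    distinct.\<close>
  have "inj_on f (verts ?K)"
    using inj adj by (fastforce simp: f_def complete_bipartite_def inj_on_def adjacent_def)
  moreover have "f ` verts ?K \<subseteq> verts H"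
    using verts by (auto simp: f_def complete_bipartite_def)
  moreover have "inj_on \<phi> (edges ?K)"
    using inj_line by (fastforce simp: complete_bipartite_def inj_on_def \<phi>)
  moreover have "\<phi> ` edges ?K \<subseteq> edges H"
    using adjacent_line(1)[OF H adj] by (auto simp: complete_bipartite_def \<phi>)
  moreover have "\<forall>e\<in>edges ?K. f ` e \<subseteq> \<phi> e"
    using adjacent_line(2,3)[OF H adj] by (auto simp: complete_bipartite_def \<phi> f_def)
  ultimately show ?thesis
    unfolding contains_Berge_def is_Berge_def
    by (intro exI[of _ "\<phi> ` edges ?K"] conjI exI[of _ f] exI[of _ \<phi>])
      (auto simp: inj_on_imp_bij_betw)
qed

text \<open>The fibre lies on the edge \<open>l\<close>, which has \<open>r\<close> vertices
  including \<open>a\<close>, and \<open>a\<close> is not adjacent to itself.\<close>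

lemma card_line_fibre_le:
  assumes H: "r_graph r H" "linear_hypergraph H" and "r > 0"
    and adj: "\<And>x. x \<in> W \<Longrightarrow> adjacent H a x"
  shows "card {x\<in>W. line H a x = l} \<le> r - 1"
proof (cases "{x\<in>W. line H a x = l} = {}")
  case True
  then show ?thesis by (metis card.empty le0)
next
  case False
  then have l: "l \<in> edges H" "a \<in> l"
    using adjacent_line[OF H adj] by auto
  then have "card l = r" using H(1) by (auto simp: r_graph_def)
  then have "finite l" using \<open>r > 0\<close> by (metis card.infinite less_irrefl)
  have "{x\<in>W. line H a x = l} \<subseteq> l - {a}"
    using adjacent_line(3)[OF H adj] adj by (auto simp: adjacent_def)
  then have "card {x\<in>W. line H a x = l} \<le> card (l - {a})"
    using \<open>finite l\<close> by (intro card_mono) auto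
  with l \<open>card l = r\<close> show ?thesis by simp
qed

text \<open>If \<open>x\<close> and \<open>y\<close> had the same image, both lines would be the
  edge through \<open>x\<close> and \<open>y\<close>. That edge would contain \<open>a\<close>,
  \<open>b\<close> and \<open>x\<close>, so it would be the line of \<open>a\<close> and
  \<open>b\<close>, which avoids \<open>W\<close>.\<close>

lemma line_pair_inj:
  assumes H: "r_graph r H" "linear_hypergraph H" and "a \<noteq> b"
    and adj: "\<And>x. x \<in> W \<Longrightarrow> adjacent H a x" "\<And>x. x \<in> W \<Longrightarrow> adjacent H b x"
    and off: "W \<inter> line H a b = {}"
  shows "inj_on (\<lambda>x. (line H a x, line H b x)) W"
proof (rule inj_onI, rule ccontr)
  fix x y
  assume xy: "x \<in> W" "y \<in> W" "x \<noteq> y" and "(line H a x, line H b x) = (line H a y, line H b y)"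
  then have eq: "line H a x = line H a y" "line H b x = line H b y" by auto
  note la = adjacent_line[OF H adj(1)] and lb = adjacent_line[OF H adj(2)]
  have "line H x y = line H a x"
    using la[OF xy(1)] la[OF xy(2)] eq xy by (intro line_eqI[OF H]) auto
  moreover have "line H x y = line H b x"
    using lb[OF xy(1)] lb[OF xy(2)] eq xy by (intro line_eqI[OF H]) auto
  ultimately have "line H a b = line H a x"
    using la[OF xy(1)] lb[OF xy(1)] \<open>a \<noteq> b\<close> by (intro line_eqI[OF H]) auto
  with la[OF xy(1)] xy(1) off show False by auto
qed

section \<open>From the matching to the Berge copy\<close>

theorem theorem2p1:
  fixes H :: "'a hypergraph" and n r t :: nat and u v w :: 'a and W :: "'a set"
  assumes "n \<ge> r" and "r \<ge> 3" and "t \<ge> 3"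
    and "r_graph r H" and "linear_hypergraph H" and "card (verts H) = n"
    and "u \<in> verts H" and "w \<in> verts H" and "adjacent H u w"
    and "v \<in> nbhd H u - {w}"
    and "W \<subseteq> (nbhd H v \<inter> nbhd H u \<inter> nbhd H w) - (line H v u \<union> line H v w \<union> line H u w)"
    and "\<forall>u\<^sub>1\<in>W. \<forall>u\<^sub>2\<in>W. u\<^sub>1 \<noteq> u\<^sub>2 \<longrightarrow> line H v u\<^sub>1 \<noteq> line H v u\<^sub>2"
    and "card W \<ge> (t - 1) * (r - 1) + 1"
  shows "contains_Berge H (complete_bipartite 3 t)"
proof -
  note H = assms(4,5)
  have adjW: "adjacent H u x" "adjacent H v x" "adjacent H w x" "x \<in> verts H" if "x \<in> W" for x
    using that assms(11) by (auto simp: nbhd_def)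
  have offW: "x \<notin> line H v u" "x \<notin> line H v w" "x \<notin> line H u w" if "x \<in> W" for x
    using that assms(11) by auto
  have vneq: "u \<noteq> w" "u \<noteq> v" "v \<noteq> w" and "v \<in> verts H"
    using assms(9,10) by (auto simp: nbhd_def adjacent_def)
  have "W \<subseteq> verts H" using adjW by auto
  then have finW: "finite W"
    using H(1) by (auto simp: r_graph_def intro: finite_subset)
  let ?h = "\<lambda>x. (line H u x, line H w x)"
  have injh: "inj_on ?h W"
    using adjW offW vneq by (intro line_pair_inj[OF H]) auto
  have "\<exists>M\<subseteq>?h ` W. matching M \<and> card M = Suc (t - 1)"
  proof (rule matching_of_bounded_degree)
    \<comment> \<open>Injectivity of \<open>?h\<close> turns degrees in the bipartite graph into
      fibre sizes of a single line map on \<open>W\<close>.\<close>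
    have *: "card {p\<in>?h ` W. P p} = card {x\<in>W. P (?h x)}" for P
    proof -
      have "{p\<in>?h ` W. P p} = ?h ` {x\<in>W. P (?h x)}" by auto
      then show ?thesis
        using card_image[OF inj_on_subset[OF injh, of "{x\<in>W. P (?h x)}"]] by auto
    qed
    show "card {p\<in>?h ` W. fst p = a} \<le> r - 1" for a
      using card_line_fibre_le[OF H _ adjW(1), of W a] assms(2) by (simp add: *)
    show "card {p\<in>?h ` W. snd p = b} \<le> r - 1" for b
      using card_line_fibre_le[OF H _ adjW(3), of W b] assms(2) by (simp add: *)
    show "(t - 1) * (r - 1) < card (?h ` W)"
      using assms(13) by (simp add: card_image[OF injh])
  qed (use finW in simp)
  then obtain M where M: "M \<subseteq> ?h ` W" "matching M" "card M = t"
    using assms(3) by auto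
  then obtain S where S: "S \<subseteq> W" "inj_on ?h S" "?h ` S = M"
    unfolding subset_image_inj by blast
  then have "card S = t" using M(3) card_image[OF S(2)] by simp
  \<comment> \<open>The matching separates the lines through \<open>u\<close> and those through
    \<open>w\<close>; the hypothesis on \<open>W\<close> separates those through
    \<open>v\<close>.\<close>
  have injS: "line H u x \<noteq> line H u y" "line H w x \<noteq> line H w y" "line H v x \<noteq> line H v y"
    if "x \<in> S" "y \<in> S" "x \<noteq> y" for x y
  proof -
    have "?h x \<in> M" "?h y \<in> M" "?h x \<noteq> ?h y"
      using S that by (auto simp: inj_on_def)
    then show "line H u x \<noteq> line H u y" "line H w x \<noteq> line H w y"
      using M(2) inj_onD[of fst M "?h x" "?h y"] inj_onD[of snd M "?h x" "?h y"]
      unfolding matching_def fst_conv snd_conv by blast+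
    show "line H v x \<noteq> line H v y" using S that assms(12) by blast
  qed
  \<comment> \<open>An edge equal to both lines contains \<open>a\<close>, \<open>b\<close> and
    \<open>x\<close>, so it is the line of \<open>a\<close> and \<open>b\<close>, which misses
    \<open>x\<close>.\<close>
  have cross: "line H a x \<noteq> line H b y"
    if "x \<in> W" "a \<noteq> b" "adjacent H a x" "adjacent H b y" "x \<notin> line H a b" for a b x y
  proof
    assume eq: "line H a x = line H b y"
    have "line H a b = line H a x"
      using adjacent_line[OF H that(3)] adjacent_line[OF H that(4)] eq that(2)
      by (intro line_eqI[OF H]) auto
    with adjacent_line[OF H that(3)] that(5) show False by auto
  qed
  have "finite S" using S finW finite_subset by auto
  then obtain q where q: "bij_betw q {..<t} S"
    using ex_bij_betw_nat_finite[of S] \<open>card S = t\<close> by (auto simp: atLeast0LessThan)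
  then have qS: "q j \<in> S" "q j \<in> W" if "j < t" for j
    using that S(1) by (auto simp: bij_betw_def)
  have q_inj: "q i = q j \<longleftrightarrow> i = j" if "i < t" "j < t" for i j
    using q that by (auto simp: bij_betw_def inj_on_def)
  \<comment> \<open>In the order \<open>v\<close>, \<open>u\<close>, \<open>w\<close>, increasing
    index pairs give exactly the three lines excluded by \<open>offW\<close>, with arguments in the
    same order.\<close>
  define p where "p = (\<lambda>i::nat. [v, u, w] ! i)"
  have less3: "i < 3 \<longleftrightarrow> i = 0 \<or> i = 1 \<or> i = 2" for i :: nat by auto
  have p: "p 0 = v" "p (Suc 0) = u" "p 2 = w" by (auto simp: p_def numeral_2_eq_2)
  show ?thesis
  proof (rule contains_Berge_complete_bipartite[OF H])
    show "inj_on p {..<3}" using vneq by (auto simp: inj_on_def less3 p)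
    show "inj_on q {..<t}" using q by (auto simp: bij_betw_def)
    show "p ` {..<3} \<subseteq> verts H" using assms(7,8) \<open>v \<in> verts H\<close> by (auto simp: less3 p)
    show "q ` {..<t} \<subseteq> verts H" using qS adjW(4) by auto
    show "adjacent H (p i) (q j)" if "i < 3" "j < t" for i j
      using that adjW qS by (auto simp: less3 p)
    have "i = i' \<and> j = j'"
      if ij: "i < 3" "i' < 3" "j < t" "j' < t" and eq: "line H (p i) (q j) = line H (p i') (q j')"
      for i i' j j'
    proof -
      have "line H (p k) (q l) \<noteq> line H (p k') (q l')"
        if "k < k'" "k' < 3" "l < t" "l' < t" for k k' l l'
      proof -
        consider "k = 0" "k' = Suc 0" | "k = 0" "k' = 2" | "k = Suc 0" "k' = 2"
          using \<open>k < k'\<close> \<open>k' < 3\<close> by linarith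
        then show ?thesis
        proof cases
          case 1
          then show ?thesis
            using cross[OF _ _ adjW(2) adjW(1)] offW(1) qS(2) vneq that(3,4) by (simp add: p)
        next
          case 2
          then show ?thesis
            using cross[OF _ _ adjW(2) adjW(3)] offW(2) qS(2) vneq that(3,4) by (simp add: p)
        next
          case 3
          then show ?thesis
            using cross[OF _ _ adjW(1) adjW(3)] offW(3) qS(2) vneq that(3,4) by (simp add: p)
        qed
      qed
      then have "i = i'"
        using ij eq by (metis nat_neq_iff)
      moreover have "q j = q j'"
      proof (rule ccontr)
        assume "q j \<noteq> q j'"
        from injS[OF qS(1) qS(1) this] ij eq \<open>i = i'\<close> show False by (auto simp: less3 p)
      qed
      ultimately show ?thesis using q_inj ij by simp
    qed
    then show "inj_on (\<lambda>(i, j). line H (p i) (q j)) ({..<3} \<times> {..<t})"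
      by (auto simp: inj_on_def)
  qed
qed

end
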